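(* Let $n\ge 1$, $N=\{1,\dots,n\}$, and consider the variant $(\mathcal{T}_n,* )$ of the full transformation semigroup with sandwich element $\alpha=\theta_1$, i.e. $\beta*\gamma=\beta\theta_1\gamma$. Then: (a) the set of idempotents is $E(\mathcal{T}_n,* )=\{\theta_i: i=1,\dots,n\}$; (b) $\displaystyle\mathfrak{I}(\mathcal{T}_n,* )=\mathfrak{CI}(\mathcal{T}_n,* )=\mathfrak{RC}(\mathcal{T}_n,* )=\Big\{\bigcup_{i\in X}\sqrt{\theta_i}:\varnothing\ne X\subseteq N\Big\}$; (c) $\mathfrak{LC}(\mathcal{T}_n,* )=\mathfrak{C}(\mathcal{T}_n,* )=\{\mathcal{T}_n\}$.
   Context: $\mathcal{T}_n$ is the set of all maps $N\to N$, composed from left to right: $(\beta\gamma)(x)=\gamma(\beta(x))$. For $i\in N$, $\theta_i\in\mathcal{T}_n$ is the constant map with value $i$. For an idempotent $\varepsilon$ of $(\mathcal{T}_n,* )$, $\sqrt{\varepsilon}$ is the set of all $\beta\in\mathcal{T}_n$ some $*$-power of which equals $\varepsilon$. Subsemigroups are non-empty. A subsemigroup $T$ of a semigroup $S$ is: isolated if $x^j\in T$ for some $j>0$ implies $x\in T$; completely isolated if $xy\in T$ implies $x\in T$ or $y\in T$; right convex if $xy\in T$ implies $y\in T$; left convex if $xy\in T$ implies $x\in T$; convex if $xy\in T$ implies $x\in T$ and $y\in T$ (for all $x,y\in S$). $\mathfrak{I}(S)$, $\mathfrak{CI}(S)$, $\mathfrak{RC}(S)$, $\mathfrak{LC}(S)$,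 $\mathfrak{C}(S)$ denote the sets of all isolated, completely isolated, right convex, left convex, and convex subsemigroups of $S$, respectively. *)

theory Defs
  imports Main "HOL-Library.FuncSet"
begin

text \<open>A semigroup is given by a carrier set \<open>S\<close> and a multiplication \<open>m\<close> on it.\<close>

text \<open>Only positive exponents are meaningful: a semigroup has no unit.\<close>

fun sg_pow :: "('a \<Rightarrow> 'a \<Rightarrow> 'a) \<Rightarrow> 'a \<Rightarrow> nat \<Rightarrow> 'a" where
  "sg_pow m x 0 = undefined"
| "sg_pow m x (Suc 0) = x"
| "sg_pow m x (Suc (Suc j)) = m (sg_pow m x (Suc j)) x"

definition idempotents :: "'a set \<Rightarrow> ('a \<Rightarrow> 'a \<Rightarrow> 'a) \<Rightarrow> 'a set" where
  "idempotents S m = {x \<in> S. m x x = x}"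

definition sg_root :: "'a set \<Rightarrow> ('a \<Rightarrow> 'a \<Rightarrow> 'a) \<Rightarrow> 'a \<Rightarrow> 'a set" where
  "sg_root S m e = {x \<in> S. \<exists>j>0. sg_pow m x j = e}"

definition subsemigroup :: "'a set \<Rightarrow> ('a \<Rightarrow> 'a \<Rightarrow> 'a) \<Rightarrow> 'a set \<Rightarrow> bool" where
  "subsemigroup S m T \<longleftrightarrow> T \<noteq> {} \<and> T \<subseteq> S \<and> (\<forall>x\<in>T. \<forall>y\<in>T. m x y \<in> T)"

definition isolated_subsemigroups :: "'a set \<Rightarrow> ('a \<Rightarrow> 'a \<Rightarrow> 'a) \<Rightarrow> 'a set set" where
  "isolated_subsemigroups S m =
    {T. subsemigroup S m T \<and> (\<forall>x\<in>S. (\<exists>j>0. sg_pow m x j \<in> T) \<longrightarrow> x \<in> T)}"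

definition completely_isolated_subsemigroups :: "'a set \<Rightarrow> ('a \<Rightarrow> 'a \<Rightarrow> 'a) \<Rightarrow> 'a set set" where
  "completely_isolated_subsemigroups S m =
    {T. subsemigroup S m T \<and> (\<forall>x\<in>S. \<forall>y\<in>S. m x y \<in> T \<longrightarrow> x \<in> T \<or> y \<in> T)}"

definition right_convex_subsemigroups :: "'a set \<Rightarrow> ('a \<Rightarrow> 'a \<Rightarrow> 'a) \<Rightarrow> 'a set set" where
  "right_convex_subsemigroups S m =
    {T. subsemigroup S m T \<and> (\<forall>x\<in>S. \<forall>y\<in>S. m x y \<in> T \<longrightarrow> y \<in> T)}"

definition left_convex_subsemigroups :: "'a set \<Rightarrow> ('a \<Rightarrow> 'a \<Rightarrow> 'a) \<Rightarrow> 'a set set" where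
  "left_convex_subsemigroups S m =
    {T. subsemigroup S m T \<and> (\<forall>x\<in>S. \<forall>y\<in>S. m x y \<in> T \<longrightarrow> x \<in> T)}"

definition convex_subsemigroups :: "'a set \<Rightarrow> ('a \<Rightarrow> 'a \<Rightarrow> 'a) \<Rightarrow> 'a set set" where
  "convex_subsemigroups S m =
    {T. subsemigroup S m T \<and> (\<forall>x\<in>S. \<forall>y\<in>S. m x y \<in> T \<longrightarrow> x \<in> T \<and> y \<in> T)}"

text \<open>Maps on \<open>{1..n}\<close> are extensional functions, so that equality of functions is
  equality of maps.\<close>

definition full_trans :: "nat \<Rightarrow> (nat \<Rightarrow> nat) set" where
  "full_trans n = ({1..n} \<rightarrow>\<^sub>E {1..n})"

text \<open>Maps are composed from left to right, whereas \<^const>\<open>compose\<close> applies its last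
  argument first.\<close>

definition trans_mult :: "nat \<Rightarrow> (nat \<Rightarrow> nat) \<Rightarrow> (nat \<Rightarrow> nat) \<Rightarrow> (nat \<Rightarrow> nat)" where
  "trans_mult n \<beta> \<gamma> = compose {1..n} \<gamma> \<beta>"

definition const_trans :: "nat \<Rightarrow> nat \<Rightarrow> (nat \<Rightarrow> nat)" where
  "const_trans n i = (\<lambda>x\<in>{1..n}. i)"

definition variant_mult ::
    "nat \<Rightarrow> (nat \<Rightarrow> nat) \<Rightarrow> (nat \<Rightarrow> nat) \<Rightarrow> (nat \<Rightarrow> nat) \<Rightarrow> (nat \<Rightarrow> nat)" where
  "variant_mult n \<alpha> \<beta> \<gamma> = trans_mult n (trans_mult n \<beta> \<alpha>) \<gamma>"

end

theory Submission
  imports Defs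
begin

text \<open>The product \<open>\<beta> * \<gamma>\<close> is the constant map with value \<open>\<gamma> 1\<close>. Hence
  \<open>\<beta> * \<beta>\<close> is the constant map with value \<open>\<beta> 1\<close>, and the root of \<open>\<theta>\<^sub>i\<close> consists of
  the \<open>\<beta>\<close> with \<open>\<beta> 1 = i\<close>, so an isolated subsemigroup is determined by the values
  that its elements take at 1. Since the product does not depend on its left factor, a left convex
  subsemigroup contains every map.\<close>

lemma sg_pow_closed:
  assumes "\<And>x y. x \<in> S \<Longrightarrow> y \<in> S \<Longrightarrow> m x y \<in> S" and "x \<in> S"
  shows "sg_pow m x (Suc j) \<in> S"
  using assms by (induction j) auto

text \<open>Descent on the exponent: a power with exponent above 1 is the previous power times
  \<open>x\<close>, so if it lies in \<open>T\<close>, then so does \<open>x\<close> or that smaller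
  power. Closure keeps the smaller power in \<open>S\<close>, where complete isolation
  applies.\<close>

lemma completely_isolated_imp_isolated:
  assumes closed: "\<And>x y. x \<in> S \<Longrightarrow> y \<in> S \<Longrightarrow> m x y \<in> S"
  shows "completely_isolated_subsemigroups S m \<subseteq> isolated_subsemigroups S m"
proof
  fix T assume T: "T \<in> completely_isolated_subsemigroups S m"
  have "x \<in> T" if "x \<in> S" "sg_pow m x (Suc j) \<in> T" for x j
    using that(2)
  proof (induction j)
    case (Suc j)
    moreover have "sg_pow m x (Suc j) \<in> S"
      using closed that(1) by (rule sg_pow_closed)
    ultimately show ?case
      using T that(1) unfolding completely_isolated_subsemigroups_def by auto
  qed simp
  then show "T \<in> isolated_subsemigroups S m"
    using T unfolding completely_isolated_subsemigroups_def isolated_subsemigroups_def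
    by (auto simp: gr0_conv_Suc)
qed

lemma right_convex_imp_completely_isolated:
  "right_convex_subsemigroups S m \<subseteq> completely_isolated_subsemigroups S m"
  unfolding right_convex_subsemigroups_def completely_isolated_subsemigroups_def by blast

lemma convex_imp_left_convex: "convex_subsemigroups S m \<subseteq> left_convex_subsemigroups S m"
  unfolding convex_subsemigroups_def left_convex_subsemigroups_def by blast

lemma const_trans_in_full_trans: "i \<in> {1..n} \<Longrightarrow> const_trans n i \<in> full_trans n"
  unfolding const_trans_def full_trans_def by auto

lemma full_trans_apply: "\<beta> \<in> full_trans n \<Longrightarrow> k \<in> {1..n} \<Longrightarrow> \<beta> k \<in> {1..n}"
  unfolding full_trans_def by (rule PiE_mem)

text \<open>The sandwich element sends the whole image of \<beta> to \<open>k\<close>, so \<gamma>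
  is only ever evaluated at \<open>k\<close>. Outside \<open>{1..n}\<close> both sides are
  \<open>undefined\<close>.\<close>

lemma variant_mult_const_trans:
  assumes "\<beta> \<in> full_trans n" "k \<in> {1..n}"
  shows "variant_mult n (const_trans n k) \<beta> \<gamma> = const_trans n (\<gamma> k)"
proof
  fix x
  show "variant_mult n (const_trans n k) \<beta> \<gamma> x = const_trans n (\<gamma> k) x"
    using full_trans_apply[OF assms(1)]
    by (auto simp: variant_mult_def trans_mult_def compose_def const_trans_def)
qed

lemma sg_root_variant_const:
  assumes k: "k \<in> {1..n}" and i: "i \<in> {1..n}"
  shows "sg_root (full_trans n) (variant_mult n (const_trans n k)) (const_trans n i) =
    {\<beta> \<in> full_trans n. \<beta> k = i}"
    (is "sg_root _ ?m _ = _")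
proof (intro equalityI subsetI)
  have closed: "?m \<beta> \<gamma> \<in> full_trans n" if "\<beta> \<in> full_trans n" "\<gamma> \<in> full_trans n" for \<beta> \<gamma>
    using that k by (simp only: variant_mult_const_trans const_trans_in_full_trans full_trans_apply)
  fix \<beta> assume "\<beta> \<in> sg_root (full_trans n) ?m (const_trans n i)"
  then obtain j where \<beta>: "\<beta> \<in> full_trans n" and j: "sg_pow ?m \<beta> (Suc j) = const_trans n i"
    unfolding sg_root_def by (auto simp: gr0_conv_Suc)
  \<comment> \<open>The value at \<open>k\<close> is the same for all positive powers: from the
    square on, each is the constant map with value \<open>\<beta> k\<close>.\<close>
  have "sg_pow ?m \<beta> (Suc j) k = \<beta> k"
  proof (cases j)
    case (Suc l)
    have "sg_pow ?m \<beta> (Suc l) \<in> full_trans n"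
      using closed \<beta> by (rule sg_pow_closed)
    then show ?thesis
      \<comment> \<open>Two calls, because unfolding \<open>const_trans\<close> at once would
        destroy the pattern of the product rule.\<close>
      using Suc k by (simp add: variant_mult_const_trans) (simp add: const_trans_def)
  qed simp
  then show "\<beta> \<in> {\<beta> \<in> full_trans n. \<beta> k = i}"
    using \<beta> j k by (simp add: const_trans_def)
next
  fix \<beta> assume \<beta>: "\<beta> \<in> {\<beta> \<in> full_trans n. \<beta> k = i}"
  \<comment> \<open>The exponent is 2, since \<beta> itself may fail to be constant.\<close>
  then have "sg_pow ?m \<beta> (Suc (Suc 0)) = const_trans n i"
    using k by (simp add: variant_mult_const_trans)
  then show "\<beta> \<in> sg_root (full_trans n) ?m (const_trans n i)"
    using \<beta> unfolding sg_root_def by blast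
qed

theorem proposition32:
  fixes n :: nat
  assumes "n \<ge> 1"
  defines "S \<equiv> full_trans n"
    and "m \<equiv> variant_mult n (const_trans n 1)"
  shows "idempotents S m = {const_trans n i | i. i \<in> {1..n}}
    \<and> (isolated_subsemigroups S m = completely_isolated_subsemigroups S m
       \<and> completely_isolated_subsemigroups S m = right_convex_subsemigroups S m
       \<and> right_convex_subsemigroups S m =
           {\<Union>i\<in>X. sg_root S m (const_trans n i) | X. X \<noteq> {} \<and> X \<subseteq> {1..n}})
    \<and> (left_convex_subsemigroups S m = convex_subsemigroups S m
       \<and> convex_subsemigroups S m = {S})"
proof -
  have one: "1 \<in> {1..n}" using assms(1) by simp
  have mult: "m \<beta> \<gamma> = const_trans n (\<gamma> 1)" if "\<beta> \<in> S" for \<beta> \<gamma>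
    using that one unfolding S_def m_def by (rule variant_mult_const_trans)
  have val: "\<beta> 1 \<in> {1..n}" if "\<beta> \<in> S" for \<beta>
    using that one unfolding S_def by (rule full_trans_apply)
  have const: "const_trans n i \<in> S" if "i \<in> {1..n}" for i
    using that unfolding S_def by (rule const_trans_in_full_trans)
  have const1: "const_trans n i 1 = i" for i
    using one by (simp add: const_trans_def)
  have closed: "m \<beta> \<gamma> \<in> S" if "\<beta> \<in> S" "\<gamma> \<in> S" for \<beta> \<gamma>
    using that by (simp only: mult const val)
  have root: "sg_root S m (const_trans n i) = {\<beta> \<in> S. \<beta> 1 = i}" if "i \<in> {1..n}" for i
    using one that unfolding S_def m_def by (rule sg_root_variant_const)
  have union: "(\<Union>i\<in>X. sg_root S m (const_trans n i)) = {\<beta> \<in> S. \<beta> 1 \<in> X}" if "X \<subseteq> {1..n}" for X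
  proof -
    have "(\<Union>i\<in>X. sg_root S m (const_trans n i)) = (\<Union>i\<in>X. {\<beta> \<in> S. \<beta> 1 = i})"
      using that by (intro SUP_cong refl root) (rule subsetD)
    then show ?thesis by auto
  qed
  define R where "R = {\<Union>i\<in>X. sg_root S m (const_trans n i) | X. X \<noteq> {} \<and> X \<subseteq> {1..n}}"
  have idem: "idempotents S m = {const_trans n i | i. i \<in> {1..n}}"
  proof (intro equalityI subsetI)
    fix \<beta> assume "\<beta> \<in> idempotents S m"
    then have "\<beta> \<in> S" "m \<beta> \<beta> = \<beta>" by (auto simp: idempotents_def)
    with mult val have "\<beta> = const_trans n (\<beta> 1)" "\<beta> 1 \<in> {1..n}" by metis+
    then show "\<beta> \<in> {const_trans n i | i. i \<in> {1..n}}" by blast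
  next
    fix \<beta> assume "\<beta> \<in> {const_trans n i | i. i \<in> {1..n}}"
    then obtain i where "i \<in> {1..n}" "\<beta> = const_trans n i" by blast
    then show "\<beta> \<in> idempotents S m"
      using const by (simp only: idempotents_def mem_Collect_eq mult const1)
  qed
  \<comment> \<open>Together with \<open>rc\<close> and the two general inclusions, this closes a
    cycle: isolated, \<open>R\<close>, right convex, completely isolated, isolated. Hence all four
    sets agree.\<close>
  have iso: "isolated_subsemigroups S m \<subseteq> R"
  proof
    fix T assume "T \<in> isolated_subsemigroups S m"
    then have T: "T \<noteq> {}" "T \<subseteq> S" "\<And>\<beta> \<gamma>. \<beta> \<in> T \<Longrightarrow> \<gamma> \<in> T \<Longrightarrow> m \<beta> \<gamma> \<in> T"
      and isoT: "\<And>\<beta> j. \<beta> \<in> S \<Longrightarrow> j > 0 \<Longrightarrow> sg_pow m \<beta> j \<in> T \<Longrightarrow> \<beta> \<in> T"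
      unfolding isolated_subsemigroups_def subsemigroup_def by auto
    let ?X = "(\<lambda>\<beta>. \<beta> 1) ` T"
    have X: "?X \<noteq> {}" "?X \<subseteq> {1..n}" using T(1,2) val by blast+
    have "\<gamma> \<in> T" if "\<gamma> \<in> S" "\<beta> \<in> T" "\<gamma> 1 = \<beta> 1" for \<beta> \<gamma>
    proof (rule isoT)
      \<comment> \<open>Maps that agree at 1 have the same square, and the square of \<beta> is in
        \<open>T\<close>; isolation then yields \<gamma>.\<close>
      have "m \<gamma> \<gamma> = m \<beta> \<beta>" using that T(2) mult by auto
      then show "sg_pow m \<gamma> (Suc (Suc 0)) \<in> T" using T(3) that(2) by simp
    qed (use that in auto)
    then have "T = {\<beta> \<in> S. \<beta> 1 \<in> ?X}" using T(2) by auto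
    then have "T = (\<Union>i\<in>?X. sg_root S m (const_trans n i))" using union[OF X(2)] by simp
    then show "T \<in> R" unfolding R_def using X by blast
  qed
  have rc: "R \<subseteq> right_convex_subsemigroups S m"
  proof
    fix T assume "T \<in> R"
    then obtain X where X: "X \<noteq> {}" "X \<subseteq> {1..n}" and T: "T = {\<beta> \<in> S. \<beta> 1 \<in> X}"
      unfolding R_def using union by blast
    \<comment> \<open>The product and its right factor agree at 1. One direction gives closure of
      \<open>T\<close>, the other right convexity. The simplifier turns \<open>1\<close> into
      \<open>Suc 0\<close>, hence the unfolded form of \<open>const1\<close>.\<close>
    have iff: "m \<beta> \<gamma> \<in> T \<longleftrightarrow> \<gamma> \<in> T" if "\<beta> \<in> S" "\<gamma> \<in> S" for \<beta> \<gamma>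
      using that closed[OF that] by (simp add: T mult const1[unfolded One_nat_def])
    obtain i where "i \<in> X" using X(1) by blast
    then have "const_trans n i \<in> T" using X(2) const const1 by (auto simp: T)
    moreover have "T \<subseteq> S" by (auto simp: T)
    ultimately show "T \<in> right_convex_subsemigroups S m"
      unfolding right_convex_subsemigroups_def subsemigroup_def using iff by blast
  qed
  have lc: "left_convex_subsemigroups S m \<subseteq> {S}"
  proof
    fix T assume "T \<in> left_convex_subsemigroups S m"
    then have T: "T \<noteq> {}" "T \<subseteq> S" "\<And>\<beta> \<gamma>. \<beta> \<in> T \<Longrightarrow> \<gamma> \<in> T \<Longrightarrow> m \<beta> \<gamma> \<in> T"
      and lcT: "\<And>\<beta> \<gamma>. \<beta> \<in> S \<Longrightarrow> \<gamma> \<in> S \<Longrightarrow> m \<beta> \<gamma> \<in> T \<Longrightarrow> \<beta> \<in> T"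
      unfolding left_convex_subsemigroups_def subsemigroup_def by auto
    obtain \<beta> where \<beta>: "\<beta> \<in> T" using T(1) by blast
    have "\<gamma> \<in> T" if "\<gamma> \<in> S" for \<gamma>
    proof (rule lcT[OF that])
      show "\<beta> \<in> S" using \<beta> T(2) by blast
      \<comment> \<open>Replacing the left factor of the square of \<beta> by an arbitrary \<gamma>
        changes nothing, so the product stays in \<open>T\<close>.\<close>
      then have "m \<gamma> \<beta> = m \<beta> \<beta>" using that by (simp only: mult)
      then show "m \<gamma> \<beta> \<in> T" using T(3) \<beta> by simp
    qed
    then show "T \<in> {S}" using T(2) by blast
  qed
  \<comment> \<open>The constant map with value 1 witnesses that \<open>S\<close> is
    non-empty.\<close>
  have "S \<in> convex_subsemigroups S m"
    unfolding convex_subsemigroups_def subsemigroup_def using closed const[OF one] by blast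
  with lc convex_imp_left_convex[of S m]
  have "left_convex_subsemigroups S m = convex_subsemigroups S m \<and> convex_subsemigroups S m = {S}"
    by blast
  moreover have "isolated_subsemigroups S m = completely_isolated_subsemigroups S m
      \<and> completely_isolated_subsemigroups S m = right_convex_subsemigroups S m
      \<and> right_convex_subsemigroups S m = R"
    using iso rc right_convex_imp_completely_isolated[of S m]
      completely_isolated_imp_isolated[of S m, OF closed] by blast
  ultimately show ?thesis using idem unfolding R_def by blast
qed

end
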